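(* Let $X$ be a perfectly normal topological space and let $A$ be a nonempty subset of $X$ which is both an $F_\sigma$-subset and a $G_\delta$-subset of $X$. Suppose that there is a continuous map $g\colon X\setminus A\to A$. Then there exists a linear operator $\varphi^\star\colon \mathfrak{fcBor}(A,\mathbb{R})\to\mathfrak{fcBor}(X,\mathbb{R})$ such that: (i) $\varphi^\star$ is an extension operator, i.e. $\varphi^\star(f)(a)=f(a)$ for every $f\in\mathfrak{fcBor}(A,\mathbb{R})$ and every $a\in A$; (ii) $\varphi^\star$ is non-negative, i.e. $\varphi^\star(f)\ge 0$ on $X$ whenever $f\in\mathfrak{fcBor}(A,\mathbb{R})$ and $f\geq 0$ on $A$; (iii) $\varphi^\star$ preserves unity, i.e. it maps the constant function $1$ on $A$ to the constant function $1$ on $X$; (iv) the restriction of $\varphi^\star$ to $\mathfrak{fcBor}^b(A,\mathbb{R})$ is an isometry for the supremum norms, i.e. $\|\varphi^\star(f)\|_X=\|f\|_A$ for every $f\in\mathfrak{fcBor}^b(A,\mathbb{R})$.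
   Context: For topological spaces $X,Y$, a function $f\colon X\to Y$ is of the first Borel class if $f^{-1}(U)$ is an $F_\sigma$-subset of $X$ (a countable union of closed sets) for every open $U\subset Y$. The family of all such functions is denoted $\mathfrak{fcBor}(X,Y)$. For a subset $A\subset X$, $\mathfrak{fcBor}(A,Y)$ is defined in the same way with $A$ carrying the subspace topology. $\mathfrak{fcBor}^b(A,\mathbb{R})$ denotes the bounded elements of $\mathfrak{fcBor}(A,\mathbb{R})$, and $\|f\|_A=\sup_{x\in A}|f(x)|$ (similarly $\|\cdot\|_X$). Real-valued functions are added, scaled and ordered pointwise. A space is perfectly normal if it is normal and every open subset is $F_\sigma$. *)

theory Defs
  imports "HOL-Analysis.Analysis"
begin

definition perfectly_normal_space :: "'a topology \<Rightarrow> bool" where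
  "perfectly_normal_space X \<longleftrightarrow>
     normal_space X \<and> (\<forall>U. openin X U \<longrightarrow> fsigma_in X U)"

text \<open>
  A map is represented by an extensional function, so that two elements of \<open>fcBor X Y\<close>
  are equal iff they agree on \<open>topspace X\<close>. For a subset \<open>A\<close> of \<open>topspace X\<close> one uses
  \<open>fcBor (subtopology X A) Y\<close>. Accordingly, pointwise sums, scalar multiples and constants
  are restricted to the relevant domain below.
\<close>

definition fcBor :: "'a topology \<Rightarrow> 'b topology \<Rightarrow> ('a \<Rightarrow> 'b) set" where
  "fcBor X Y =
     {f \<in> topspace X \<rightarrow>\<^sub>E topspace Y.
        \<forall>U. openin Y U \<longrightarrow> fsigma_in X {x \<in> topspace X. f x \<in> U}}"

definition fcBor_bounded :: "'a topology \<Rightarrow> ('a \<Rightarrow> real) set" where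
  "fcBor_bounded X = {f \<in> fcBor X euclideanreal. bounded (f ` topspace X)}"

text \<open>
  Only meaningful for functions that are bounded on a nonempty set \<open>S\<close>; the supremum of an
  empty or unbounded set of reals is unspecified.
\<close>

definition sup_norm :: "'a set \<Rightarrow> ('a \<Rightarrow> real) \<Rightarrow> real" where
  "sup_norm S f = (SUP x\<in>S. \<bar>f x\<bar>)"

definition fcBor_linear_operator ::
  "'a topology \<Rightarrow> 'b topology \<Rightarrow> (('a \<Rightarrow> real) \<Rightarrow> ('b \<Rightarrow> real)) \<Rightarrow> bool" where
  "fcBor_linear_operator S T \<phi> \<longleftrightarrow>
     \<phi> \<in> fcBor S euclideanreal \<rightarrow> fcBor T euclideanreal \<and>
     (\<forall>f\<in>fcBor S euclideanreal. \<forall>h\<in>fcBor S euclideanreal.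
        \<phi> (\<lambda>x\<in>topspace S. f x + h x) = (\<lambda>y\<in>topspace T. \<phi> f y + \<phi> h y)) \<and>
     (\<forall>c::real. \<forall>f\<in>fcBor S euclideanreal.
        \<phi> (\<lambda>x\<in>topspace S. c * f x) = (\<lambda>y\<in>topspace T. c * \<phi> f y))"

end

theory Submission
  imports Defs
begin

text \<open>
  The map \<open>r\<close> that is the identity on \<open>A\<close> and \<open>g\<close> on the complement of \<open>A\<close> is a (usually
  discontinuous) retraction of \<open>X\<close> onto \<open>A\<close>, and the extension operator is composition with
  it: \<open>f \<mapsto> f \<circ> r\<close>. Linearity, positivity and preservation of unity are then immediate, and the
  operator is isometric because \<open>f \<circ> r\<close> takes on \<open>X\<close> exactly the values that \<open>f\<close> takes on \<open>A\<close>.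

  The only topological point is that \<open>f \<circ> r\<close> is again of the first Borel class. For this it
  suffices that preimages under \<open>r\<close> of \<open>F\<^sub>\<sigma>\<close>-subsets of \<open>A\<close> are \<open>F\<^sub>\<sigma>\<close> in \<open>X\<close>
  (\<open>fsigma_in_preimage_piecewise\<close>): both \<open>A\<close> and its complement are \<open>F\<^sub>\<sigma>\<close> in \<open>X\<close>, so the
  \<open>F\<^sub>\<sigma>\<close>-subsets of these two pieces, on each of which \<open>r\<close> is continuous, are \<open>F\<^sub>\<sigma>\<close> in \<open>X\<close>.
\<close>

lemma fsigma_in_continuous_map_preimage:
  assumes g: "continuous_map X Y g" and S: "fsigma_in Y S"
  shows "fsigma_in X {x \<in> topspace X. g x \<in> S}"
proof -
  obtain C :: "nat \<Rightarrow> _" where C: "\<And>n. closedin Y (C n)" and "\<Union> (range C) = S"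
    using S by (auto simp: fsigma_in_ascending)
  then have "{x \<in> topspace X. g x \<in> S} = \<Union> (range (\<lambda>n. {x \<in> topspace X. g x \<in> C n}))"
    by auto
  moreover have "fsigma_in X (\<Union> (range (\<lambda>n. {x \<in> topspace X. g x \<in> C n})))"
    using C by (intro fsigma_in_Union)
      (auto intro: closed_imp_fsigma_in closedin_continuous_map_preimage [OF g])
  ultimately show ?thesis
    by simp
qed

lemma fsigma_in_preimage_piecewise:
  assumes A: "fsigma_in X A" and B: "fsigma_in X (topspace X - A)"
    and h: "continuous_map (subtopology X A) Y h"
    and g: "continuous_map (subtopology X (topspace X - A)) Y g"
    and S: "fsigma_in Y S"
  shows "fsigma_in X {x \<in> topspace X. (if x \<in> A then h x else g x) \<in> S}"
proof -
  have "fsigma_in X {x \<in> topspace (subtopology X A). h x \<in> S}"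
    using fsigma_in_continuous_map_preimage [OF h S] fsigma_in_fsigma_subtopology [OF A] by blast
  moreover have "fsigma_in X {x \<in> topspace (subtopology X (topspace X - A)). g x \<in> S}"
    using fsigma_in_continuous_map_preimage [OF g S] fsigma_in_fsigma_subtopology [OF B] by blast
  moreover have "{x \<in> topspace X. (if x \<in> A then h x else g x) \<in> S} =
      {x \<in> topspace (subtopology X A). h x \<in> S} \<union>
      {x \<in> topspace (subtopology X (topspace X - A)). g x \<in> S}"
    by auto
  ultimately show ?thesis
    by (simp only: fsigma_in_Un)
qed

lemma fcBor_compose:
  assumes f: "f \<in> fcBor Y Z" and r: "r \<in> topspace X \<rightarrow> topspace Y"
    and pre: "\<And>S. fsigma_in Y S \<Longrightarrow> fsigma_in X {x \<in> topspace X. r x \<in> S}"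
  shows "(\<lambda>x\<in>topspace X. f (r x)) \<in> fcBor X Z"
proof -
  have "fsigma_in X {x \<in> topspace X. (\<lambda>x\<in>topspace X. f (r x)) x \<in> U}" if "openin Z U" for U
  proof -
    have "fsigma_in Y {y \<in> topspace Y. f y \<in> U}"
      using f that by (auto simp: fcBor_def)
    from pre [OF this] show ?thesis
      by (rule back_subst) (use r in auto)
  qed
  then show ?thesis
    using f r by (auto simp: fcBor_def)
qed

theorem theorem2:
  fixes X :: "'a topology" and A :: "'a set" and g :: "'a \<Rightarrow> 'a"
  assumes "perfectly_normal_space X"
    and "A \<subseteq> topspace X" and "A \<noteq> {}"
    and "fsigma_in X A" and "gdelta_in X A"
    and "continuous_map (subtopology X (topspace X - A)) (subtopology X A) g"
  shows "\<exists>\<phi> :: ('a \<Rightarrow> real) \<Rightarrow> ('a \<Rightarrow> real).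
      fcBor_linear_operator (subtopology X A) X \<phi> \<and>
      (\<forall>f \<in> fcBor (subtopology X A) euclideanreal. \<forall>a\<in>A. \<phi> f a = f a) \<and>
      (\<forall>f \<in> fcBor (subtopology X A) euclideanreal.
         (\<forall>a\<in>A. 0 \<le> f a) \<longrightarrow> (\<forall>x\<in>topspace X. 0 \<le> \<phi> f x)) \<and>
      \<phi> (\<lambda>a\<in>A. 1) = (\<lambda>x\<in>topspace X. 1) \<and>
      (\<forall>f \<in> fcBor_bounded (subtopology X A).
         \<phi> f \<in> fcBor_bounded X \<and> sup_norm (topspace X) (\<phi> f) = sup_norm A f)"
proof -
  define r where "r x = (if x \<in> A then x else g x)" for x
  define \<phi> :: "('a \<Rightarrow> real) \<Rightarrow> ('a \<Rightarrow> real)"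
    where "\<phi> f = (\<lambda>x\<in>topspace X. f (r x))" for f
  have topA: "topspace (subtopology X A) = A"
    using assms(2) by (rule topspace_subtopology_subset)
  have gA: "g x \<in> A" if "x \<in> topspace X - A" for x
    using assms(6) that by (auto simp: continuous_map_def Pi_iff)
  then have rA: "r x \<in> A" if "x \<in> topspace X" for x
    using that by (auto simp: r_def)
  have r_id: "r a = a" if "a \<in> A" for a
    using that by (simp add: r_def)
  have r_image: "r ` topspace X = A"
    using rA r_id assms(2) by force
  have image: "\<phi> f ` topspace X = f ` A" for f
  proof -
    have "\<phi> f ` topspace X = f ` (r ` topspace X)"
      by (simp add: \<phi>_def image_image)
    then show ?thesis
      by (simp only: r_image)
  qed
  have pre: "fsigma_in X {x \<in> topspace X. r x \<in> S}" if "fsigma_in (subtopology X A) S" for S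
  proof -
    have "fsigma_in X (topspace X - A)"
      using assms(5) by (simp add: gdelta_in_fsigma_in)
    moreover have "continuous_map (subtopology X A) (subtopology X A) (\<lambda>x. x)"
      by simp
    ultimately show ?thesis
      unfolding r_def by (rule fsigma_in_preimage_piecewise [OF assms(4) _ _ assms(6) that])
  qed
  have mem: "\<phi> f \<in> fcBor X euclideanreal" if "f \<in> fcBor (subtopology X A) euclideanreal" for f
    unfolding \<phi>_def using that _ pre by (rule fcBor_compose) (use rA assms(2) in auto)
  show ?thesis
  proof (intro exI [of _ \<phi>] conjI ballI impI)
    show "fcBor_linear_operator (subtopology X A) X \<phi>"
      unfolding fcBor_linear_operator_def topA using mem
      by (auto simp: \<phi>_def rA intro!: restrict_ext)
    show "\<phi> f a = f a" if "a \<in> A" for f a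
      using that assms(2) by (auto simp: \<phi>_def r_id)
    show "0 \<le> \<phi> f x" if "\<forall>a\<in>A. 0 \<le> f a" "x \<in> topspace X" for f x
      using that by (simp add: \<phi>_def rA)
    show "\<phi> (\<lambda>a\<in>A. 1) = (\<lambda>x\<in>topspace X. 1)"
      by (auto simp: \<phi>_def rA intro!: restrict_ext)
  next
    fix f assume f: "f \<in> fcBor_bounded (subtopology X A)"
    then show "\<phi> f \<in> fcBor_bounded X"
      using mem by (simp add: fcBor_bounded_def topA image del: topspace_subtopology)
    have "(\<lambda>x. \<bar>\<phi> f x\<bar>) ` topspace X = (\<lambda>a. \<bar>f a\<bar>) ` A"
      using image [of f] by (metis image_image)
    then show "sup_norm (topspace X) (\<phi> f) = sup_norm A f"
      by (simp only: sup_norm_def)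
  qed
qed

end
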